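(* Let $\delta>0$. Assume that $\epsilon(\cdot)$ satisfies the controlled decay condition $(\mathrm{CD})_K$ (see context) for some $K>0$, that $\int_{t_0}^{+\infty}\epsilon^{\frac32}(t)\,dt<+\infty$, and that $$\lim_{t\to+\infty}\frac{1}{\sqrt{\epsilon(t)}\,\exp\left(\int_{t_0}^t(\delta-K)\sqrt{\epsilon(s)}\,ds\right)}=0 .$$ Then, for any global solution trajectory $x:[t_0,+\infty[\to\mathcal H$ of $$\ddot x(t)+\delta\sqrt{\epsilon(t)}\,\dot x(t)+\nabla f(x(t))+\epsilon(t)x(t)=0,$$ one has $$\liminf_{t\to+\infty}\|x(t)-x^*\|=0,$$ where $x^*$ is the element of minimal norm of $\operatorname{argmin} f$, that is, $x^*=\operatorname{proj}_{\operatorname{argmin} f}0$. Further, if there exists $T\ge t_0$ such that the trajectory $\{x(t):t\ge T\}$ stays either in the open ball $B(0,\|x^*\|)$ or in its complement, then $x(t)$ converges strongly to $x^*$ as $t\to+\infty$.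
   Context: $\mathcal H$ is a real Hilbert space with scalar product $\langle\cdot,\cdot\rangle$ and norm $\|\cdot\|$. The function $f:\mathcal H\to\mathbb R$ is convex and differentiable, $\nabla f$ is Lipschitz continuous on bounded sets, and $\operatorname{argmin} f\ne\emptyset$. The function $\epsilon:[t_0,+\infty[\to\mathbb R^+$ is nonincreasing, of class $C^1$, takes positive values, and $\lim_{t\to\infty}\epsilon(t)=0$. $B(0,\rho)=\{x\in\mathcal H:\|x\|<\rho\}$. Condition $(\mathrm{CD})_K$: given $\delta>0$, the nonincreasing function $\epsilon$ satisfies $(\mathrm{CD})_K$ if there exists $t_1\ge t_0$ such that for all $t\ge t_1$ $$\left(\frac{1}{\sqrt{\epsilon}}\right)'(t)\le\min(2K-\delta,\ \delta-K),$$ where $K$ is a parameter such that $\frac{\delta}{2}<K<\delta$ if $0<\delta\le2$, and $\frac{\delta+\sqrt{\delta^2-4}}{2}<K<\delta$ if $\delta>2$. Solutions are classical (twice differentiable) solutions on $[t_0,+\infty[$. *)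

theory Defs
  imports "HOL-Analysis.Analysis"
begin

definition argmin_set :: "('a \<Rightarrow> real) \<Rightarrow> 'a set" where
  "argmin_set f = {x. is_arg_min f (\<lambda>_. True) x}"

(* The library's closest_point is restricted to Heine-Borel spaces, i.e. to finite dimension.
   As there, the value is meaningful only if S has a (here: unique) point nearest to a,
   e.g. if S is nonempty, closed and convex in a Hilbert space. *)
definition metric_proj :: "'a::metric_space set \<Rightarrow> 'a \<Rightarrow> 'a" where
  "metric_proj S a = (THE p. p \<in> S \<and> (\<forall>y\<in>S. dist a p \<le> dist a y))"

definition lipschitz_on_bounded_sets ::
    "('a::metric_space \<Rightarrow> 'b::metric_space) \<Rightarrow> bool" where
  "lipschitz_on_bounded_sets g \<longleftrightarrow> (\<forall>B. bounded B \<longrightarrow> (\<exists>L. L-lipschitz_on B g))"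

(* Functions on [t0, +oo) are represented by total functions on the reals; derivatives are taken
   within {t0..}, hence are one-sided at t0 and independent of the values before t0. *)
definition C1_on_ray :: "real \<Rightarrow> (real \<Rightarrow> real) \<Rightarrow> bool" where
  "C1_on_ray t0 e \<longleftrightarrow>
     (\<exists>e'. (\<forall>t\<ge>t0. (e has_real_derivative e' t) (at t within {t0..})) \<and> continuous_on {t0..} e')"

definition controlled_decay :: "real \<Rightarrow> real \<Rightarrow> real \<Rightarrow> (real \<Rightarrow> real) \<Rightarrow> bool" where
  "controlled_decay K \<delta> t0 \<epsilon> \<longleftrightarrow>
     (if \<delta> \<le> 2 then \<delta> / 2 < K else (\<delta> + sqrt (\<delta>\<^sup>2 - 4)) / 2 < K) \<and> K < \<delta> \<and>
     (\<exists>t1\<ge>t0. \<forall>t\<ge>t1. \<exists>D.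
        ((\<lambda>s. 1 / sqrt (\<epsilon> s)) has_real_derivative D) (at t within {t0..}) \<and>
        D \<le> min (2 * K - \<delta>) (\<delta> - K))"

definition global_solution ::
    "real \<Rightarrow> real \<Rightarrow> (real \<Rightarrow> real) \<Rightarrow> ('a::real_normed_vector \<Rightarrow> 'a) \<Rightarrow> (real \<Rightarrow> 'a) \<Rightarrow> bool" where
  "global_solution t0 \<delta> \<epsilon> g x \<longleftrightarrow>
     (\<exists>x' x''. \<forall>t\<ge>t0.
        (x has_vector_derivative x' t) (at t within {t0..}) \<and>
        (x' has_vector_derivative x'' t) (at t within {t0..}) \<and>
        x'' t + (\<delta> * sqrt (\<epsilon> t)) *\<^sub>R x' t + g (x t) + \<epsilon> t *\<^sub>R x t = 0)"

end

theory Submission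
  imports Defs
begin

text \<open>
  Write \<open>a = sqrt \<epsilon>\<close>, \<open>h = (1 / a)'\<close> and let \<open>p\<close> be the minimizer of minimal norm. The proof
  rests on two facts.

  Every point that nearly minimizes \<open>f\<close> and whose norm barely exceeds \<open>norm p\<close> is close to \<open>p\<close> in
  norm (lemma \<open>minimal_norm_well_posed\<close>). This follows from the parallelogram law and
  completeness, and it reduces strong convergence to two scalar statements: \<open>f (x t)\<close> tends to the
  minimum, and \<open>norm (x t)\<close> is eventually at most \<open>norm p + \<eta>\<close>.

  Both scalar statements come from the energy
  \<open>E = f x - f p + a\<^sup>2 / 2 * ((norm x)\<^sup>2 - (norm p)\<^sup>2) + (norm (K a (x - p) + x'))\<^sup>2 / 2\<close>.
  Differentiating, and using convexity of \<open>f\<close>, gives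
  \<open>E' + (\<delta> - K + h) a E \<le> K a\<^sup>3 (norm p)\<^sup>2\<close>, and even \<open>\<le> 0\<close> while \<open>norm p \<le> norm x\<close>
  (lemma \<open>energy_dissipation\<close>); the controlled decay condition supplies the bounds on
  \<open>h\<close> and \<open>K\<close> that this needs. Since \<open>h a = - a' / a\<close>, the integrating factor is \<open>\<gamma> = G / a\<close> with
  \<open>G = exp (\<integral> (\<delta> - K) a)\<close>, and the growth hypothesis says that \<open>\<epsilon> \<gamma> = a G\<close> tends to infinity.
  Consequently \<open>limsup E \<le> 0\<close>, which forces \<open>f (x t)\<close> to its minimum along every trajectory. If
  the trajectory eventually stays out of the open ball of radius \<open>norm p\<close>, then \<open>E \<le> C / \<gamma>\<close>
  and therefore \<open>(norm x)\<^sup>2 - (norm p)\<^sup>2 \<le> 2 E / \<epsilon>\<close> is at most \<open>2 C / (a G)\<close>, which tends to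
  \<open>0\<close> (lemma \<open>trajectory_energy_decay\<close>).

  A trajectory that eventually stays in the ball satisfies the norm bound trivially. One that does
  neither returns to the ball at arbitrarily late times and comes close to \<open>p\<close> there, so the
  lower limit is \<open>0\<close> in every case.
\<close>

section \<open>Minimizers of minimal norm\<close>

lemma convex_gradient_inequality:
  fixes f :: "'a::real_inner \<Rightarrow> real"
  assumes "convex_on UNIV f" and "GDERIV f x :> g"
  shows "f x + inner g (y - x) \<le> f y"
proof -
  define \<phi> where "\<phi> s = f (x + s *\<^sub>R (y - x))" for s :: real
  have "((\<lambda>s. x + s *\<^sub>R (y - x)) has_derivative (\<lambda>s. s *\<^sub>R (y - x))) (at 0)"
    by (auto intro!: derivative_eq_intros)
  from has_derivative_compose[OF this, of f "\<lambda>h. inner h g"]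
  have "(\<phi> has_real_derivative inner g (y - x)) (at 0)"
    using assms(2)
    unfolding \<phi>_def gderiv_def has_field_derivative_def
    by (simp add: inner_commute mult.commute[of _ "inner g (y - x)"])
  then have "((\<lambda>s. (\<phi> s - \<phi> 0) / s) \<longlongrightarrow> inner g (y - x)) (at_right 0)"
    by (auto simp: has_field_derivative_iff intro: tendsto_mono[OF at_within_le_at])
  moreover have "eventually (\<lambda>s. (\<phi> s - \<phi> 0) / s \<le> f y - f x) (at_right 0)"
  proof -
    have "(\<phi> s - \<phi> 0) / s \<le> f y - f x" if "0 < s" "s < 1" for s
    proof -
      have "x + s *\<^sub>R (y - x) = (1 - s) *\<^sub>R x + s *\<^sub>R y"
        by (simp add: algebra_simps)
      then have "\<phi> s \<le> (1 - s) * f x + s * f y"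
        using convex_onD[OF assms(1), of s x y] that by (simp add: \<phi>_def)
      then show ?thesis
        using that by (simp add: \<phi>_def field_simps)
    qed
    then show ?thesis
      by (intro eventually_at_rightI[of 0 1]) auto
  qed
  ultimately have "inner g (y - x) \<le> f y - f x"
    by (intro tendsto_upperbound) auto
  then show ?thesis by simp
qed

lemma parallelogram_midpoint:
  fixes x y :: "'a::real_inner"
  shows "(norm (x - y))\<^sup>2 = 2 * (norm x)\<^sup>2 + 2 * (norm y)\<^sup>2 - 4 * (norm (midpoint x y))\<^sup>2"
  by (simp add: midpoint_def power2_norm_eq_inner inner_add_left inner_add_right
      inner_diff_left inner_diff_right inner_commute field_simps)

lemma convex_on_midpoint_le:
  assumes "convex_on UNIV f" "f x \<le> c" "f y \<le> c"
  shows "f (midpoint x y) \<le> (c::real)"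
proof -
  have "f (midpoint x y) \<le> f x / 2 + f y / 2"
    using convex_onD[OF assms(1), of "1/2" x y]
    by (simp add: midpoint_def scaleR_right_distrib)
  then show ?thesis using assms by linarith
qed

text \<open>
  The infimum of the squared norm over the sublevel set at height \<open>min f + \<eta>\<close> increases to some
  \<open>M\<close> as \<open>\<eta>\<close> decreases to \<open>0\<close>. The nearly minimizing points whose squared norm is nearly at
  most \<open>M\<close> form nested closed sets, and midpoints of such points have squared norm nearly at
  least \<open>M\<close>, so by the parallelogram law their diameters tend to \<open>0\<close>. By completeness they
  shrink to a point, which is the minimizer of minimal norm. One argument thus yields both
  the projection and strong convergence to it.
\<close>

lemma minimal_norm_well_posed:
  fixes f :: "'a::{real_inner, complete_space} \<Rightarrow> real"
  assumes conv: "convex_on UNIV f" and cont: "continuous_on UNIV f"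
    and ne: "argmin_set f \<noteq> {}"
  obtains p where "p \<in> argmin_set f" "metric_proj (argmin_set f) 0 = p"
    "\<And>e. e > 0 \<Longrightarrow> \<exists>\<eta>>0. \<forall>y. f y \<le> f p + \<eta> \<longrightarrow> norm y \<le> norm p + \<eta> \<longrightarrow> norm (y - p) < e"
proof -
  obtain z where z: "z \<in> argmin_set f"
    using ne by blast
  have argmin_iff: "y \<in> argmin_set f \<longleftrightarrow> f y \<le> f z" for y
    using z by (auto simp: argmin_set_def is_arg_min_linorder intro: order_trans)
  have min: "f z \<le> f y" for y
    using z by (auto simp: argmin_set_def is_arg_min_linorder)
  define L where "L \<eta> = {y. f y \<le> f z + \<eta>}" for \<eta>
  define N where "N \<eta> = Inf ((\<lambda>y. (norm y)\<^sup>2) ` L \<eta>)" for \<eta>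
  define M where "M = Sup (N ` {0<..})"
  have L_argmin: "y \<in> L \<eta>" if "y \<in> argmin_set f" "\<eta> > 0" for y \<eta>
    using that argmin_iff[of y] by (simp add: L_def)
  have N_le: "N \<eta> \<le> (norm y)\<^sup>2" if "y \<in> L \<eta>" for \<eta> y
    unfolding N_def using that by (intro cInf_lower bdd_belowI[of _ 0]) auto
  have M_le: "M \<le> (norm y)\<^sup>2" if "y \<in> argmin_set f" for y
    unfolding M_def using N_le L_argmin[OF that] by (intro cSup_least) auto
  have N_le_M: "N \<eta> \<le> M" if "\<eta> > 0" for \<eta>
    unfolding M_def using that N_le L_argmin[OF z]
    by (intro cSup_upper bdd_aboveI[of _ "(norm z)\<^sup>2"]) auto
  define S where "S \<eta> = {y. f y \<le> f z + \<eta> \<and> (norm y)\<^sup>2 \<le> M + \<eta>}" for \<eta>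
  have small: "\<exists>\<eta>>0. \<forall>y\<in>S \<eta>. \<forall>y'\<in>S \<eta>. dist y y' < e" if "e > 0" for e
  proof -
    \<comment> \<open>The parallelogram law bounds the squared distance by \<open>8 \<kappa>\<close>, which this choice makes
      smaller than \<open>e\<^sup>2\<close>.\<close>
    define \<kappa> where "\<kappa> = e\<^sup>2 / 16"
    have "\<kappa> > 0" using that by (simp add: \<kappa>_def)
    then obtain \<eta>' where \<eta>': "\<eta>' > 0" "N \<eta>' > M - \<kappa>"
      using less_cSup_iff[of "N ` {0<..}" "M - \<kappa>"] N_le_M
      by (force simp: M_def[symmetric] intro!: bdd_aboveI[of _ M])
    define \<eta> where "\<eta> = min \<eta>' \<kappa>"
    have "dist y y' < e" if "y \<in> S \<eta>" "y' \<in> S \<eta>" for y y'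
    proof -
      have "midpoint y y' \<in> L \<eta>'"
        using that convex_on_midpoint_le[OF conv, of y "f z + \<eta>" y']
        by (simp add: S_def L_def \<eta>_def)
      then have "M - \<kappa> \<le> (norm (midpoint y y'))\<^sup>2"
        using N_le[of "midpoint y y'" \<eta>'] \<eta>' by linarith
      moreover have "(norm y)\<^sup>2 \<le> M + \<kappa>" "(norm y')\<^sup>2 \<le> M + \<kappa>"
        using that by (auto simp: S_def \<eta>_def)
      ultimately have "(norm (y - y'))\<^sup>2 \<le> 8 * \<kappa>"
        using parallelogram_midpoint[of y y'] by linarith
      also have "\<dots> < e\<^sup>2"
        using \<open>e > 0\<close> by (simp add: \<kappa>_def)
      finally show ?thesis
        using \<open>e > 0\<close> by (simp add: dist_norm power_less_imp_less_base)
    qed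
    moreover have "\<eta> > 0"
      using \<eta>' \<open>\<kappa> > 0\<close> by (simp add: \<eta>_def)
    ultimately show ?thesis by blast
  qed
  have S_mono: "S \<eta> \<subseteq> S \<eta>'" if "\<eta> \<le> \<eta>'" for \<eta> \<eta>'
    using that by (auto simp: S_def)
  have nonempty: "S \<eta> \<noteq> {}" if "\<eta> > 0" for \<eta>
  proof -
    have "L \<eta> \<noteq> {}" "N \<eta> < M + \<eta>"
      using L_argmin[OF z that] N_le_M[OF that] that by auto
    then obtain y where "y \<in> L \<eta>" "(norm y)\<^sup>2 < M + \<eta>"
      using cInf_lessD[of "(\<lambda>y. (norm y)\<^sup>2) ` L \<eta>" "M + \<eta>"] by (auto simp: N_def)
    then show ?thesis by (auto simp: S_def L_def)
  qed
  have closed: "closed (S \<eta>)" for \<eta>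
    unfolding S_def using cont
    by (intro closed_Collect_conj closed_Collect_le continuous_intros)
  define s where "s n = 1 / real (Suc n)" for n
  have s_small: "\<exists>n. s n \<le> \<eta>" if "\<eta> > 0" for \<eta>
    using reals_Archimedean[OF that] by (auto simp: s_def inverse_eq_divide intro: less_imp_le)
  obtain p where p: "\<And>n. p \<in> S (s n)"
  proof (rule decreasing_closed_nest[of "\<lambda>n. S (s n)"])
    show "S (s n) \<subseteq> S (s m)" if "m \<le> n" for m n
      using that by (intro S_mono) (simp add: s_def frac_le)
    show "\<exists>n. \<forall>x\<in>S (s n). \<forall>y\<in>S (s n). dist x y < e" if "e > 0" for e
      using small[OF that] s_small S_mono by (meson subsetD)
  qed (use closed nonempty in \<open>auto simp: s_def\<close>)
  have p_S: "p \<in> S \<eta>" if "\<eta> > 0" for \<eta>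
    using p s_small[OF that] S_mono by blast
  have "f p \<le> f z"
    by (rule field_le_epsilon) (use p_S in \<open>simp add: S_def\<close>)
  then have p_argmin: "p \<in> argmin_set f"
    by (simp add: argmin_iff)
  have "(norm p)\<^sup>2 \<le> M"
    by (rule field_le_epsilon) (use p_S in \<open>simp add: S_def\<close>)
  then have p_norm: "(norm p)\<^sup>2 = M"
    using M_le[OF p_argmin] by simp
  have fp: "f p = f z"
    using p_argmin argmin_iff min by (simp add: antisym)
  have well_posed: "\<exists>\<eta>>0. \<forall>y. f y \<le> f p + \<eta> \<longrightarrow> norm y \<le> norm p + \<eta> \<longrightarrow> norm (y - p) < e"
    if e: "e > 0" for e
  proof -
    obtain \<eta> where \<eta>: "\<eta> > 0" "\<And>y y'. y \<in> S \<eta> \<Longrightarrow> y' \<in> S \<eta> \<Longrightarrow> dist y y' < e"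
      using small[OF e] by blast
    \<comment> \<open>A norm at most \<open>norm p + \<theta>\<close> has square at most \<open>M + \<eta>\<close>.\<close>
    define \<theta> where "\<theta> = min (min 1 \<eta>) (\<eta> / (2 * norm p + 1))"
    have pos: "2 * norm p + 1 > 0" by (simp add: add_nonneg_pos)
    have \<theta>: "0 < \<theta>" "\<theta> \<le> 1" "\<theta> \<le> \<eta>" "(2 * norm p + 1) * \<theta> \<le> \<eta>"
    proof -
      have "\<theta> \<le> \<eta> / (2 * norm p + 1)"
        by (simp add: \<theta>_def)
      then show "(2 * norm p + 1) * \<theta> \<le> \<eta>"
        using pos by (simp add: pos_le_divide_eq mult.commute)
    qed (use \<eta>(1) pos in \<open>auto simp: \<theta>_def\<close>)
    have "norm (y - p) < e" if y: "f y \<le> f p + \<theta>" "norm y \<le> norm p + \<theta>" for y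
    proof -
      have "(norm y)\<^sup>2 \<le> (norm p + \<theta>)\<^sup>2"
        using y(2) by (intro power_mono) auto
      also have "\<dots> = M + (2 * norm p + \<theta>) * \<theta>"
        using p_norm by (simp add: power2_eq_square algebra_simps)
      also have "\<dots> \<le> M + (2 * norm p + 1) * \<theta>"
        using \<theta> by (intro add_left_mono mult_right_mono) auto
      finally have "y \<in> S \<eta>"
        using \<theta> y(1) fp by (simp add: S_def)
      then show ?thesis
        using \<eta>(2)[OF _ p_S[OF \<eta>(1)]] by (simp add: dist_norm)
    qed
    then show ?thesis using \<theta>(1) by blast
  qed
  have p_least: "norm p \<le> norm y" if "y \<in> argmin_set f" for y
    using M_le[OF that] p_norm by (intro power2_le_imp_le[OF _ norm_ge_zero]) simp
  have "metric_proj (argmin_set f) 0 = p"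
    unfolding metric_proj_def
  proof (rule the_equality)
    fix q assume q: "q \<in> argmin_set f \<and> (\<forall>y\<in>argmin_set f. dist 0 q \<le> dist 0 y)"
    have "norm (q - p) < e" if "e > 0" for e
    proof -
      have "f q \<le> f p" "norm q \<le> norm p"
        using q p_argmin argmin_iff fp by auto
      with well_posed[OF that] show ?thesis
        by (metis add_increasing2 less_imp_le)
    qed
    then have "norm (q - p) \<le> 0"
      by (meson less_irrefl not_le)
    then show "q = p" by simp
  qed (use p_argmin p_least in auto)
  with p_argmin well_posed show ?thesis using that by blast
qed

section \<open>Dissipation of the energy\<close>

text \<open>
  With \<open>a = sqrt (\<epsilon> t)\<close>, the first two summands are the gap between the values at \<open>x\<close> and at
  \<open>p\<close> of the Tikhonov function \<open>y \<mapsto> f y + \<epsilon> t / 2 * (norm y)\<^sup>2\<close>; \<open>v\<close> stands for the velocity.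
\<close>

definition energy :: "('a::real_inner \<Rightarrow> real) \<Rightarrow> 'a \<Rightarrow> real \<Rightarrow> real \<Rightarrow> 'a \<Rightarrow> 'a \<Rightarrow> real" where
  "energy f p K a x v = f x - f p + a\<^sup>2 / 2 * ((norm x)\<^sup>2 - (norm p)\<^sup>2)
     + (norm ((K * a) *\<^sub>R (x - p) + v))\<^sup>2 / 2"

lemma has_real_derivative_power2_norm:
  fixes u :: "real \<Rightarrow> 'a::real_inner"
  assumes "(u has_vector_derivative u') (at t)"
  shows "((\<lambda>t. (norm (u t))\<^sup>2) has_real_derivative 2 * inner (u t) u') (at t)"
proof -
  have "(u has_derivative (\<lambda>s. s *\<^sub>R u')) (at t)"
    using assms by (simp add: has_vector_derivative_def)
  from has_derivative_inner[OF this this] show ?thesis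
    unfolding power2_norm_eq_inner has_field_derivative_def
    by (rule has_derivative_eq_rhs) (simp add: fun_eq_iff inner_commute)
qed

lemma energy_has_derivative:
  fixes x v :: "real \<Rightarrow> 'a::real_inner"
  assumes "GDERIV f (x t) :> g"
    and "(a has_real_derivative a') (at t)"
    and "(x has_vector_derivative v t) (at t)"
    and "(v has_vector_derivative w) (at t)"
  shows "((\<lambda>t. energy f p K (a t) (x t) (v t)) has_real_derivative
      inner g (v t) + a t * a' * ((norm (x t))\<^sup>2 - (norm p)\<^sup>2) + (a t)\<^sup>2 * inner (x t) (v t)
      + inner ((K * a t) *\<^sub>R (x t - p) + v t)
          ((K * a') *\<^sub>R (x t - p) + (K * a t) *\<^sub>R v t + w)) (at t)"
proof -
  have df: "((\<lambda>t. f (x t)) has_real_derivative inner g (v t)) (at t)"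
    using has_derivative_compose[OF assms(3)[unfolded has_vector_derivative_def],
        of f "\<lambda>h. inner h g"] assms(1)
    by (simp add: gderiv_def has_field_derivative_def inner_commute mult_commute_abs)
  have du: "((\<lambda>t. (K * a t) *\<^sub>R (x t - p) + v t) has_vector_derivative
      (K * a') *\<^sub>R (x t - p) + (K * a t) *\<^sub>R v t + w) (at t)"
    by (auto intro!: derivative_eq_intros assms(2-4) simp: algebra_simps)
  have "((\<lambda>t. (a t)\<^sup>2 / 2) has_real_derivative a t * a') (at t)"
    using DERIV_cdivide[OF DERIV_power[OF assms(2), of 2], of 2] by (simp add: mult_ac)
  from DERIV_mult[OF this DERIV_diff[OF has_real_derivative_power2_norm[OF assms(3)] DERIV_const]]
  have dq: "((\<lambda>t. (a t)\<^sup>2 / 2 * ((norm (x t))\<^sup>2 - (norm p)\<^sup>2)) has_real_derivative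
      a t * a' * ((norm (x t))\<^sup>2 - (norm p)\<^sup>2) + (a t)\<^sup>2 * inner (x t) (v t)) (at t)"
    by (rule DERIV_cong) (simp add: algebra_simps)
  show ?thesis
    unfolding energy_def
    by (rule DERIV_cong[OF DERIV_add[OF DERIV_add[OF DERIV_diff[OF df DERIV_const] dq]
      DERIV_cdivide[OF has_real_derivative_power2_norm[OF du], of 2]]]) simp
qed

text \<open>
  Here \<open>D\<close> is the derivative of the energy when \<open>a' = - h * a\<^sup>2\<close>, that is, \<open>(1 / a)' = h\<close>.
  The rate \<open>r\<close> is the one for which the terms in \<open>inner (x - p) v\<close>, which have no sign, cancel
  in \<open>D + r * energy\<close>. What remains has the right sign by convexity and the decay condition: the term in \<open>(norm v)\<^sup>2\<close> uses \<open>h \<le> \<delta> - K\<close>,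
  the Tikhonov gap uses \<open>r \<le> K * a\<close>, that is, \<open>h \<le> 2 * K - \<delta>\<close>, and the term in
  \<open>(norm (x - p))\<^sup>2\<close> uses \<open>K * (\<delta> - K) \<le> 1\<close>. Only inside the ball of radius \<open>norm p\<close> can
  \<open>(norm x)\<^sup>2 - (norm p)\<^sup>2\<close> be negative, and it is at least \<open>- (norm p)\<^sup>2\<close>, whence the error term.
\<close>

lemma energy_dissipation:
  fixes x v p g :: "'a::real_inner"
  assumes ode: "w + (\<delta> * a) *\<^sub>R v + g + a\<^sup>2 *\<^sub>R x = 0"
    and tangent: "f x + inner g (p - x) \<le> f p" and min: "f p \<le> f x"
    and a: "0 < a" and K: "K < \<delta>" "0 < K" "K * (\<delta> - K) \<le> 1"
    and h: "0 \<le> h" "h \<le> 2 * K - \<delta>" "h \<le> \<delta> - K"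
  defines "D \<equiv> inner g v + a * (- h * a\<^sup>2) * ((norm x)\<^sup>2 - (norm p)\<^sup>2) + a\<^sup>2 * inner x v
      + inner ((K * a) *\<^sub>R (x - p) + v) ((K * (- h * a\<^sup>2)) *\<^sub>R (x - p) + (K * a) *\<^sub>R v + w)"
    and "r \<equiv> (\<delta> - K + h) * a"
  shows "D + r * energy f p K a x v \<le> K * a^3 * (norm p)\<^sup>2"
    and "norm p \<le> norm x \<Longrightarrow> D + r * energy f p K a x v \<le> 0"
proof -
  define Q F X V where "Q = (norm x)\<^sup>2 - (norm p)\<^sup>2" and "F = f x - f p"
    and "X = (norm (x - p))\<^sup>2" and "V = (norm v)\<^sup>2"
  have w: "w = - ((\<delta> * a) *\<^sub>R v + g + a\<^sup>2 *\<^sub>R x)"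
    using ode by (simp add: eq_neg_iff_add_eq_0 algebra_simps)
  have identity: "D + r * energy f p K a x v =
      - h * a^3 * Q - (2 * K - \<delta> - h) * a * (F + a\<^sup>2 * Q / 2)
      - K * a * (inner g (x - p) - F) - (\<delta> - K - h) / 2 * a * V
      - K / 2 * a^3 * (1 - K * (\<delta> - K) + K * h) * X"
    unfolding D_def r_def w energy_def Q_def F_def X_def V_def power2_norm_eq_inner
    by (simp add: inner_add_left inner_add_right inner_diff_left inner_diff_right
        inner_commute power2_eq_square power3_eq_cube field_simps)
  have "K * a * (inner g (x - p) - F) \<ge> 0" "(\<delta> - K - h) / 2 * a * V \<ge> 0"
    "K / 2 * a^3 * (1 - K * (\<delta> - K) + K * h) * X \<ge> 0"
    using tangent a K h by (simp_all add: F_def X_def V_def inner_diff_right)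
  then have bound: "D + r * energy f p K a x v \<le>
      - h * a^3 * Q - (2 * K - \<delta> - h) * a * (F + a\<^sup>2 * Q / 2)"
    using identity by linarith
  have F: "F \<ge> 0" using min by (simp add: F_def)
  show "D + r * energy f p K a x v \<le> 0" if "norm p \<le> norm x"
  proof -
    have "Q \<ge> 0" using that by (simp add: Q_def power_mono)
    then have "h * a^3 * Q \<ge> 0" "(2 * K - \<delta> - h) * a * (F + a\<^sup>2 * Q / 2) \<ge> 0"
      using F h a by simp_all
    then show ?thesis using bound by linarith
  qed
  have "- ((norm p)\<^sup>2) \<le> Q" by (simp add: Q_def)
  then have 1: "h * a^3 * - ((norm p)\<^sup>2) \<le> h * a^3 * Q"
    using h a by (intro mult_left_mono) simp_all
  have "a\<^sup>2 * - ((norm p)\<^sup>2) \<le> a\<^sup>2 * Q"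
    using \<open>- ((norm p)\<^sup>2) \<le> Q\<close> by (rule mult_left_mono) simp
  then have "- (a\<^sup>2 * (norm p)\<^sup>2 / 2) \<le> F + a\<^sup>2 * Q / 2"
    using F by simp
  then have 2: "(2 * K - \<delta> - h) * a * - (a\<^sup>2 * (norm p)\<^sup>2 / 2)
      \<le> (2 * K - \<delta> - h) * a * (F + a\<^sup>2 * Q / 2)"
    using h a by (intro mult_left_mono) simp_all
  have "(2 * K - \<delta> + h) / 2 * (a^3 * (norm p)\<^sup>2) \<le> K * (a^3 * (norm p)\<^sup>2)"
    using h K a by (intro mult_right_mono) simp_all
  with 1 2 bound show "D + r * energy f p K a x v \<le> K * a^3 * (norm p)\<^sup>2"
    by (simp add: power2_eq_square power3_eq_cube field_simps)
qed

section \<open>Decay of the energy along a trajectory\<close>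

text \<open>
  The weight \<open>\<gamma> = exp I / a\<close> has logarithmic derivative \<open>(\<delta> - K + h) * a\<close>, the dissipation rate,
  so the dissipation estimate bounds the derivative of \<open>\<gamma> * E\<close>. The error term is of order
  \<open>a^3\<close> and hence, as \<open>a\<close> tends to \<open>0\<close>, eventually below \<open>\<theta>\<close> times the rate; this makes \<open>\<gamma> * (E - \<theta>)\<close> nonincreasing
  and, as \<open>\<gamma>\<close> tends to infinity, gives \<open>limsup E \<le> \<theta>\<close> for every \<open>\<theta> > 0\<close>. Outside the ball
  there is no error term, so \<open>E \<le> C / \<gamma>\<close>, while
  \<open>E \<ge> a\<^sup>2 / 2 * ((norm x)\<^sup>2 - (norm p)\<^sup>2)\<close>. Hence \<open>(norm x)\<^sup>2 - (norm p)\<^sup>2\<close> is at most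
  \<open>2 * C / (a\<^sup>2 * \<gamma>) = 2 * C / (a * exp I)\<close>, which is the quantity that the growth hypothesis
  sends to \<open>0\<close>.
\<close>

lemma trajectory_energy_decay:
  fixes f :: "'a::real_inner \<Rightarrow> real" and x v w :: "real \<Rightarrow> 'a"
  assumes tangent: "\<And>y z. f y + inner (g y) (z - y) \<le> f z"
    and grad: "\<And>y. GDERIV f y :> g y"
    and min: "\<And>y. f p \<le> f y"
    and K: "K < \<delta>" "0 < K" "K * (\<delta> - K) \<le> 1"
    and a_pos: "\<And>t. T < t \<Longrightarrow> 0 < a t"
    and h: "\<And>t. T < t \<Longrightarrow> 0 \<le> h t" "\<And>t. T < t \<Longrightarrow> h t \<le> 2 * K - \<delta>"
      "\<And>t. T < t \<Longrightarrow> h t \<le> \<delta> - K"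
    and da: "\<And>t. T < t \<Longrightarrow> (a has_real_derivative - h t * (a t)\<^sup>2) (at t)"
    and dI: "\<And>t. T < t \<Longrightarrow> (I has_real_derivative (\<delta> - K) * a t) (at t)"
    and dx: "\<And>t. T < t \<Longrightarrow> (x has_vector_derivative v t) (at t)"
    and dv: "\<And>t. T < t \<Longrightarrow> (v has_vector_derivative w t) (at t)"
    and ode: "\<And>t. T < t \<Longrightarrow> w t + (\<delta> * a t) *\<^sub>R v t + g (x t) + (a t)\<^sup>2 *\<^sub>R x t = 0"
    and a_lim: "(a \<longlongrightarrow> 0) at_top"
    and growth: "((\<lambda>t. 1 / (a t * exp (I t))) \<longlongrightarrow> 0) at_top"
  shows "((\<lambda>t. f (x t)) \<longlongrightarrow> f p) at_top"
    and "\<lbrakk>\<forall>\<^sub>F t in at_top. norm p \<le> norm (x t); 0 < \<eta>\<rbrakk>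
      \<Longrightarrow> \<forall>\<^sub>F t in at_top. norm (x t) \<le> norm p + \<eta>"
proof -
  define E where "E t = energy f p K (a t) (x t) (v t)" for t
  define \<gamma> where "\<gamma> t = exp (I t) / a t" for t
  define r where "r t = (\<delta> - K + h t) * a t" for t
  have \<gamma>_pos: "\<gamma> t > 0" if "T < t" for t
    using a_pos[OF that] by (simp add: \<gamma>_def)
  have d\<gamma>: "(\<gamma> has_real_derivative r t * \<gamma> t) (at t)" if "T < t" for t
    unfolding \<gamma>_def r_def using a_pos[OF that]
    by (auto intro!: derivative_eq_intros dI[OF that] da[OF that]
        simp: field_simps power2_eq_square)
  have dE: "\<exists>D. (E has_real_derivative D) (at t) \<and> D + r t * E t \<le> K * (a t)^3 * (norm p)\<^sup>2
      \<and> (norm p \<le> norm (x t) \<longrightarrow> D + r t * E t \<le> 0)" if "T < t" for t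
    using energy_has_derivative[OF grad da dx dv, OF that that that]
      energy_dissipation[OF ode[OF that] tangent min a_pos[OF that] K
        h(1)[OF that] h(2)[OF that] h(3)[OF that]]
    unfolding E_def r_def by blast
  have decay: "\<gamma> t * (E t - \<theta>) \<le> \<gamma> s * (E s - \<theta>)"
    if "T < s" "s \<le> t"
      and *: "\<And>u D. \<lbrakk>s \<le> u; D + r u * E u \<le> K * (a u)^3 * (norm p)\<^sup>2;
        norm p \<le> norm (x u) \<longrightarrow> D + r u * E u \<le> 0\<rbrakk> \<Longrightarrow> D + r u * E u \<le> \<theta> * r u"
    for s t \<theta>
  proof (rule DERIV_nonpos_imp_nonincreasing[OF \<open>s \<le> t\<close>])
    fix u assume u: "s \<le> u" "u \<le> t"
    then have "T < u" using that by simp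
    from dE[OF this] obtain D where D: "(E has_real_derivative D) (at u)"
      "D + r u * E u \<le> K * (a u)^3 * (norm p)\<^sup>2"
      "norm p \<le> norm (x u) \<longrightarrow> D + r u * E u \<le> 0" by blast
    have "((\<lambda>t. \<gamma> t * (E t - \<theta>)) has_real_derivative \<gamma> u * (D + r u * E u - \<theta> * r u)) (at u)"
      by (auto intro!: derivative_eq_intros d\<gamma>[OF \<open>T < u\<close>] D(1) simp: algebra_simps)
    moreover have "\<gamma> u * (D + r u * E u - \<theta> * r u) \<le> 0"
      using *[OF u(1) D(2,3)] \<gamma>_pos[OF \<open>T < u\<close>] by (simp add: mult_nonneg_nonpos)
    ultimately show "\<exists>y. ((\<lambda>t. \<gamma> t * (E t - \<theta>)) has_real_derivative y) (at u) \<and> y \<le> 0"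
      by blast
  qed
  have a_ev: "\<forall>\<^sub>F t in at_top. T < t"
    by (rule eventually_gt_at_top)
  \<comment> \<open>The weight tends to infinity because \<open>1 / \<gamma> = a\<^sup>2 * (1 / (a * exp I))\<close>.\<close>
  have "((\<lambda>t. (a t)\<^sup>2 * (1 / (a t * exp (I t)))) \<longlongrightarrow> 0\<^sup>2 * 0) at_top"
    by (intro tendsto_intros a_lim growth)
  moreover have "\<forall>\<^sub>F t in at_top. (a t)\<^sup>2 * (1 / (a t * exp (I t))) = 1 / \<gamma> t"
    using a_ev by eventually_elim (use a_pos in \<open>auto simp: \<gamma>_def power2_eq_square\<close>)
  ultimately have \<gamma>_lim: "((\<lambda>t. 1 / \<gamma> t) \<longlongrightarrow> 0) at_top"
    by (simp add: tendsto_cong)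
  have a2_lim: "((\<lambda>t. (a t)\<^sup>2 * C) \<longlongrightarrow> 0) at_top" for C
    using tendsto_mult[OF tendsto_power[OF a_lim, of 2] tendsto_const, of C] by simp
  have E_small: "\<forall>\<^sub>F t in at_top. E t < \<eta>" if "\<eta> > 0" for \<eta>
  proof -
    define \<theta> where "\<theta> = \<eta> / 2"
    have "0 < \<theta> * (\<delta> - K)"
      using that K by (simp add: \<theta>_def)
    from order_tendstoD(2)[OF a2_lim this, of "K * (norm p)\<^sup>2"] a_ev
    have "\<forall>\<^sub>F t in at_top. T < t \<and> (a t)\<^sup>2 * (K * (norm p)\<^sup>2) < \<theta> * (\<delta> - K)"
      by eventually_elim simp
    then obtain s where s: "\<And>u. s \<le> u \<Longrightarrow> T < u \<and> (a u)\<^sup>2 * (K * (norm p)\<^sup>2) < \<theta> * (\<delta> - K)"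
      by (auto simp: eventually_at_top_linorder)
    have bound: "\<gamma> t * (E t - \<theta>) \<le> \<gamma> s * (E s - \<theta>)" if "s \<le> t" for t
    proof (rule decay[OF _ that])
      fix u D assume u: "s \<le> u" and D: "D + r u * E u \<le> K * (a u)^3 * (norm p)\<^sup>2"
      have "T < u" "(a u)\<^sup>2 * (K * (norm p)\<^sup>2) < \<theta> * (\<delta> - K)"
        using s u by auto
      have "K * (a u)^3 * (norm p)\<^sup>2 = a u * ((a u)\<^sup>2 * (K * (norm p)\<^sup>2))"
        by (simp add: power2_eq_square power3_eq_cube)
      also have "\<dots> \<le> a u * (\<theta> * (\<delta> - K + h u))"
        using s[of u] u a_pos[OF \<open>T < u\<close>] h(1)[OF \<open>T < u\<close>] that \<open>\<eta> > 0\<close>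
        by (intro mult_left_mono) (auto simp: \<theta>_def distrib_left intro: add_increasing2)
      finally show "D + r u * E u \<le> \<theta> * r u"
        using D by (simp add: r_def mult_ac)
    qed (use s in simp)
    have "((\<lambda>t. \<theta> + \<gamma> s * (E s - \<theta>) * (1 / \<gamma> t)) \<longlongrightarrow> \<theta> + \<gamma> s * (E s - \<theta>) * 0) at_top"
      by (intro tendsto_intros \<gamma>_lim)
    then have "\<forall>\<^sub>F t in at_top. \<theta> + \<gamma> s * (E s - \<theta>) * (1 / \<gamma> t) < \<eta>"
      by (rule order_tendstoD(2)) (use that in \<open>simp add: \<theta>_def\<close>)
    then show ?thesis
      using a_ev eventually_ge_at_top[of s]
    proof eventually_elim
      case (elim t)
      have "E t - \<theta> \<le> \<gamma> s * (E s - \<theta>) / \<gamma> t"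
        using bound[of t] elim \<gamma>_pos[of t] by (simp add: pos_le_divide_eq mult.commute)
      then show ?case using elim by simp
    qed
  qed
  have E_ge: "f (x t) - f p + (a t)\<^sup>2 / 2 * ((norm (x t))\<^sup>2 - (norm p)\<^sup>2) \<le> E t" for t
    by (simp add: E_def energy_def)
  show "((\<lambda>t. f (x t)) \<longlongrightarrow> f p) at_top"
  proof (rule order_tendstoI)
    fix c assume "f p < c"
    define \<eta> where "\<eta> = (c - f p) / 2"
    have \<eta>: "\<eta> > 0" using \<open>f p < c\<close> by (simp add: \<eta>_def)
    show "\<forall>\<^sub>F t in at_top. f (x t) < c"
      using E_small[OF \<eta>] order_tendstoD(2)[OF a2_lim \<eta>, of "(norm p)\<^sup>2 / 2"]
    proof eventually_elim
      case (elim t)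
      have "(a t)\<^sup>2 / 2 * ((norm (x t))\<^sup>2 - (norm p)\<^sup>2) \<ge> - ((a t)\<^sup>2 * ((norm p)\<^sup>2 / 2))"
        by (simp add: right_diff_distrib)
      with E_ge[of t] elim have "f (x t) - f p < \<eta> + \<eta>"
        by linarith
      then show ?case by (simp add: \<eta>_def)
    qed
  next
    fix c assume "c < f p"
    then have "c < f (x t)" for t
      using min[of "x t"] by linarith
    then show "\<forall>\<^sub>F t in at_top. c < f (x t)"
      by simp
  qed
  show "\<forall>\<^sub>F t in at_top. norm (x t) \<le> norm p + \<eta>"
    if outside: "\<forall>\<^sub>F t in at_top. norm p \<le> norm (x t)" and \<eta>: "0 < \<eta>"
  proof -
    obtain s where s: "\<And>u. s \<le> u \<Longrightarrow> T < u \<and> norm p \<le> norm (x u)"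
      using eventually_conj[OF a_ev outside] by (auto simp: eventually_at_top_linorder)
    have bound: "\<gamma> t * E t \<le> \<gamma> s * E s" if "s \<le> t" for t
      using decay[of s t 0] s that by simp
    have "((\<lambda>t. 2 * (\<gamma> s * E s) * (1 / (a t * exp (I t)))) \<longlongrightarrow> 2 * (\<gamma> s * E s) * 0) at_top"
      by (intro tendsto_intros growth)
    then have "\<forall>\<^sub>F t in at_top. 2 * (\<gamma> s * E s) * (1 / (a t * exp (I t))) < \<eta>\<^sup>2"
      by (rule order_tendstoD(2)) (use \<eta> in simp)
    then show ?thesis
      using a_ev eventually_ge_at_top[of s]
    proof eventually_elim
      case (elim t)
      have at: "a t > 0" using a_pos elim by simp
      have "(a t)\<^sup>2 / 2 * ((norm (x t))\<^sup>2 - (norm p)\<^sup>2) \<le> E t"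
        using E_ge[of t] min[of "x t"] by linarith
      also have "E t \<le> \<gamma> s * E s / \<gamma> t"
        using bound[of t] elim \<gamma>_pos[of t] by (simp add: pos_le_divide_eq mult.commute)
      also have "\<dots> = (a t)\<^sup>2 / 2 * (2 * (\<gamma> s * E s) * (1 / (a t * exp (I t))))"
        using at by (simp add: \<gamma>_def[of t] power2_eq_square)
      also have "\<dots> \<le> (a t)\<^sup>2 / 2 * \<eta>\<^sup>2"
        using elim(1) by (intro mult_left_mono) simp_all
      finally have "(norm (x t))\<^sup>2 - (norm p)\<^sup>2 \<le> \<eta>\<^sup>2"
        using at by simp
      then have "(norm (x t))\<^sup>2 \<le> (norm p + \<eta>)\<^sup>2"
        using \<eta> by (simp add: power2_sum add_increasing2)
      then show ?case
        by (rule power2_le_imp_le) (use \<eta> in simp)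
    qed
  qed
qed

section \<open>Strong convergence to the minimizer of minimal norm\<close>

text \<open>
  For \<open>\<delta> > 2\<close> the lower bound puts \<open>K\<close> above the larger root of \<open>X\<^sup>2 - \<delta> X + 1\<close>; for
  \<open>\<delta> \<le> 2\<close> the product is at most \<open>\<delta>\<^sup>2 / 4 \<le> 1\<close> by the inequality of arithmetic and
  geometric means.
\<close>

lemma controlled_decay_product_le:
  assumes "controlled_decay K \<delta> t0 \<epsilon>" "0 < \<delta>"
  shows "K * (\<delta> - K) \<le> 1"
proof -
  have product: "4 * (K * (\<delta> - K)) = \<delta>\<^sup>2 - (2 * K - \<delta>)\<^sup>2"
    by (simp add: power2_eq_square algebra_simps)
  show ?thesis
  proof (cases "\<delta> \<le> 2")
    case True
    then have "\<delta>\<^sup>2 \<le> 4"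
      using assms(2) power_mono[of \<delta> 2 2] by simp
    then show ?thesis
      using product zero_le_power2[of "2 * K - \<delta>"] by linarith
  next
    case False
    then have "sqrt (\<delta>\<^sup>2 - 4) \<le> 2 * K - \<delta>"
      using assms(1) by (auto simp: controlled_decay_def)
    then have "\<delta>\<^sup>2 - 4 \<le> (2 * K - \<delta>)\<^sup>2"
      by (rule sqrt_le_D)
    then show ?thesis
      using product by simp
  qed
qed

theorem theorem10:
  fixes f :: "'a::{real_inner, complete_space} \<Rightarrow> real"
    and gradf :: "'a \<Rightarrow> 'a"
    and \<epsilon> :: "real \<Rightarrow> real"
    and t0 \<delta> K :: real
    and x :: "real \<Rightarrow> 'a"
    and xstar :: 'a
  assumes "convex_on UNIV f"
    and "\<And>y. GDERIV f y :> gradf y"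
    and "lipschitz_on_bounded_sets gradf"
    and "argmin_set f \<noteq> {}"
    and "antimono_on {t0..} \<epsilon>"
    and "C1_on_ray t0 \<epsilon>"
    and "\<And>t. t \<ge> t0 \<Longrightarrow> \<epsilon> t > 0"
    and "(\<epsilon> \<longlongrightarrow> 0) at_top"
    and "\<delta> > 0"
    and "K > 0"
    and "controlled_decay K \<delta> t0 \<epsilon>"
    and "(\<lambda>t. \<epsilon> t powr (3 / 2)) integrable_on {t0..}"
    and "((\<lambda>t. 1 / (sqrt (\<epsilon> t) * exp (integral {t0..t} (\<lambda>s. (\<delta> - K) * sqrt (\<epsilon> s)))))
            \<longlongrightarrow> 0) at_top"
    and "global_solution t0 \<delta> \<epsilon> gradf x"
    and "xstar = metric_proj (argmin_set f) 0"
  shows "Liminf at_top (\<lambda>t. ereal (norm (x t - xstar))) = 0 \<and>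
    ((\<exists>T\<ge>t0. x ` {T..} \<subseteq> ball 0 (norm xstar) \<or> x ` {T..} \<subseteq> - ball 0 (norm xstar))
       \<longrightarrow> (x \<longlongrightarrow> xstar) at_top)"
proof -
  have tangent: "f y + inner (gradf y) (z - y) \<le> f z" for y z
    by (rule convex_gradient_inequality[OF assms(1) assms(2)])
  have "continuous_on UNIV f"
    using assms(2) by (auto simp: gderiv_def continuous_on_eq_continuous_at
        intro: has_derivative_continuous)
  from minimal_norm_well_posed[OF assms(1) this assms(4)]
  have argmin: "xstar \<in> argmin_set f"
    and well_posed: "\<And>e. e > 0 \<Longrightarrow>
      \<exists>\<eta>>0. \<forall>y. f y \<le> f xstar + \<eta> \<longrightarrow> norm y \<le> norm xstar + \<eta> \<longrightarrow> norm (y - xstar) < e"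
    unfolding assms(15) by metis+
  have min: "f xstar \<le> f y" for y
    using argmin by (auto simp: argmin_set_def is_arg_min_linorder)

  define a where "a t = sqrt (\<epsilon> t)" for t
  define I where "I t = integral {t0..t} (\<lambda>s. (\<delta> - K) * a s)" for t
  obtain v w where sol: "\<And>t. t0 \<le> t \<Longrightarrow> (x has_vector_derivative v t) (at t within {t0..})"
    "\<And>t. t0 \<le> t \<Longrightarrow> (v has_vector_derivative w t) (at t within {t0..})"
    "\<And>t. t0 \<le> t \<Longrightarrow> w t + (\<delta> * sqrt (\<epsilon> t)) *\<^sub>R v t + gradf (x t) + \<epsilon> t *\<^sub>R x t = 0"
    using assms(14) unfolding global_solution_def by blast
  have K: "K < \<delta>"
    using assms(11) by (simp add: controlled_decay_def)
  obtain T where T: "t0 \<le> T" and "\<forall>t\<ge>T. \<exists>D. ((\<lambda>s. 1 / sqrt (\<epsilon> s)) has_real_derivative D)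
      (at t within {t0..}) \<and> D \<le> min (2 * K - \<delta>) (\<delta> - K)"
    using assms(11) unfolding controlled_decay_def by blast
  then obtain h where h: "\<And>t. T \<le> t \<Longrightarrow> ((\<lambda>s. 1 / a s) has_real_derivative h t) (at t within {t0..})"
    "\<And>t. T \<le> t \<Longrightarrow> h t \<le> min (2 * K - \<delta>) (\<delta> - K)"
    unfolding a_def by metis
  have within: "at t within {t0..} = at t" if "T < t" for t
    using that T by (intro at_within_interior) simp
  have a_pos: "0 < a t" if "t0 \<le> t" for t
    using assms(7)[OF that] by (simp add: a_def)
  have a2: "(a t)\<^sup>2 = \<epsilon> t" if "t0 \<le> t" for t
    using assms(7)[OF that] by (simp add: a_def)
  obtain e' where "\<And>t. t \<in> {t0..} \<Longrightarrow> (\<epsilon> has_real_derivative e' t) (at t within {t0..})"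
    using assms(6) unfolding C1_on_ray_def by auto
  then have "continuous_on {t0..} \<epsilon>"
    by (rule DERIV_continuous_on)
  then have a_cont: "continuous_on {t0..} a"
    unfolding a_def[abs_def] by (rule continuous_on_real_sqrt)
  have h_nonneg: "0 \<le> h t" if "T < t" for t
  proof (rule mono_on_imp_deriv_nonneg)
    show "mono_on {t0..} (\<lambda>s. 1 / a s)"
      using assms(5) a_pos
      by (auto simp: monotone_on_def a_def intro!: divide_left_mono)
    show "((\<lambda>s. 1 / a s) has_real_derivative h t) (at t)"
      using h(1)[of t] within[OF that] that by simp
    show "t \<in> interior {t0..}"
      using that T by simp
  qed
  have da: "(a has_real_derivative - h t * (a t)\<^sup>2) (at t)" if "T < t" for t
  proof -
    have "((\<lambda>s. inverse (1 / a s)) has_real_derivative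
        - (inverse (1 / a t) * h t * inverse (1 / a t))) (at t)"
      using h(1)[of t] within[OF that] that a_pos[of t] T
      by (intro DERIV_inverse') auto
    then show ?thesis
      by (simp add: power2_eq_square mult_ac)
  qed
  have dI: "(I has_real_derivative (\<delta> - K) * a t) (at t)" if "T < t" for t
  proof -
    have "continuous_on {t0..t + 1} (\<lambda>s. (\<delta> - K) * a s)"
      by (intro continuous_on_mult_left continuous_on_subset[OF a_cont]) auto
    then have "(I has_real_derivative (\<delta> - K) * a t) (at t within {t0..t + 1})"
      unfolding I_def[abs_def] using that T by (intro integral_has_real_derivative) auto
    then show ?thesis
      using that T by (simp add: at_within_Icc_at)
  qed
  have a_lim: "(a \<longlongrightarrow> 0) at_top"
    using tendsto_real_sqrt[OF assms(8)] by (simp add: a_def[abs_def])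
  have growth: "((\<lambda>t. 1 / (a t * exp (I t))) \<longlongrightarrow> 0) at_top"
    using assms(13) by (simp add: a_def I_def)
  have ode: "w t + (\<delta> * a t) *\<^sub>R v t + gradf (x t) + (a t)\<^sup>2 *\<^sub>R x t = 0" if "T < t" for t
    using sol(3)[of t] a2[of t] that T by (simp add: a_def)
  have dx: "(x has_vector_derivative v t) (at t)" if "T < t" for t
    using sol(1)[of t] within[OF that] that T by simp
  have dv: "(v has_vector_derivative w t) (at t)" if "T < t" for t
    using sol(2)[of t] within[OF that] that T by simp
  note trajectory = trajectory_energy_decay[of f gradf xstar K \<delta> T a h I x v w,
      OF tangent assms(2) min K assms(10) controlled_decay_product_le[OF assms(11,9)]
        _ h_nonneg _ _ da dI dx dv ode a_lim growth]
  have f_lim: "((\<lambda>t. f (x t)) \<longlongrightarrow> f xstar) at_top"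
    by (rule trajectory(1)) (use h(2) a_pos T in \<open>auto simp: less_imp_le\<close>)
  have outside: "\<forall>\<^sub>F t in at_top. norm (x t) \<le> norm xstar + \<eta>"
    if "\<forall>\<^sub>F t in at_top. norm xstar \<le> norm (x t)" "0 < \<eta>" for \<eta>
    by (rule trajectory(2)) (use h(2) a_pos T that in \<open>auto simp: less_imp_le\<close>)

  \<comment> \<open>As the values of \<open>f\<close> converge to its minimum, well-posedness leaves only the norm to be
    controlled.\<close>
  have close: "\<exists>\<eta>>0. \<forall>\<^sub>F t in at_top. norm (x t) \<le> norm xstar + \<eta> \<longrightarrow> norm (x t - xstar) < e"
    if e: "e > 0" for e
  proof -
    obtain \<eta> where \<eta>: "\<eta> > 0" "\<And>y. f y \<le> f xstar + \<eta> \<Longrightarrow> norm y \<le> norm xstar + \<eta>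
        \<Longrightarrow> norm (y - xstar) < e"
      using well_posed[OF e] by blast
    have "\<forall>\<^sub>F t in at_top. f (x t) < f xstar + \<eta>"
      using \<eta>(1) by (intro order_tendstoD(2)[OF f_lim]) simp
    then have "\<forall>\<^sub>F t in at_top. norm (x t) \<le> norm xstar + \<eta> \<longrightarrow> norm (x t - xstar) < e"
      by eventually_elim (simp add: \<eta>(2))
    with \<eta>(1) show ?thesis by blast
  qed
  have convergence: "(x \<longlongrightarrow> xstar) at_top"
    if "\<And>\<eta>. \<eta> > 0 \<Longrightarrow> \<forall>\<^sub>F t in at_top. norm (x t) \<le> norm xstar + \<eta>"
  proof (rule tendstoI)
    fix e :: real assume "e > 0"
    from close[OF this] obtain \<eta> where "\<eta> > 0"
      and ev: "\<forall>\<^sub>F t in at_top. norm (x t) \<le> norm xstar + \<eta> \<longrightarrow> norm (x t - xstar) < e" by blast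
    show "\<forall>\<^sub>F t in at_top. dist (x t) xstar < e"
      using ev that[OF \<open>\<eta> > 0\<close>] by eventually_elim (simp add: dist_norm)
  qed

  \<comment> \<open>Either the trajectory eventually stays out of the open ball and converges, or it visits the
    ball at arbitrarily late times, where it is close to the projection by well-posedness.\<close>
  have frequently_close: "\<exists>\<^sub>F t in at_top. norm (x t - xstar) < e" if "e > 0" for e
  proof (cases "\<forall>\<^sub>F t in at_top. norm xstar \<le> norm (x t)")
    case True
    then have "(x \<longlongrightarrow> xstar) at_top"
      using outside convergence by blast
    then show ?thesis
      using that by (intro eventually_frequently) (auto simp: tendsto_iff dist_norm)
  next
    case False
    then have inside: "\<exists>\<^sub>F t in at_top. norm (x t) < norm xstar"
      by (simp add: frequently_def not_less)
    obtain \<eta> where "\<eta> > 0"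
      and ev: "\<forall>\<^sub>F t in at_top. norm (x t) \<le> norm xstar + \<eta> \<longrightarrow> norm (x t - xstar) < e"
      using close[OF \<open>e > 0\<close>] by blast
    show ?thesis
      using frequently_eventually_conj[OF inside ev]
      by (rule frequently_elim1) (use \<open>\<eta> > 0\<close> in auto)
  qed
  have "Liminf at_top (\<lambda>t. ereal (norm (x t - xstar))) = 0"
  proof (rule antisym)
    show "Liminf at_top (\<lambda>t. ereal (norm (x t - xstar))) \<le> 0"
    proof (rule ccontr)
      assume "\<not> ?thesis"
      then obtain e where e: "ereal 0 < ereal e"
        "ereal e < Liminf at_top (\<lambda>t. ereal (norm (x t - xstar)))"
        using ereal_dense2 by (metis not_le zero_ereal_def)
      from e(2) have "\<forall>\<^sub>F t in at_top. ereal e < ereal (norm (x t - xstar))"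
        by (rule less_LiminfD)
      then have "\<not> (\<exists>\<^sub>F t in at_top. norm (x t - xstar) < e)"
        unfolding not_frequently by eventually_elim simp
      with frequently_close[of e] e(1) show False by simp
    qed
  qed (intro Liminf_bounded always_eventually, simp)
  moreover have "(x \<longlongrightarrow> xstar) at_top"
    if "x ` {S..} \<subseteq> ball 0 (norm xstar) \<or> x ` {S..} \<subseteq> - ball 0 (norm xstar)" for S
    using that
  proof
    assume "x ` {S..} \<subseteq> ball 0 (norm xstar)"
    then have "norm (x t) < norm xstar" if "S \<le> t" for t
      using that by (auto simp: image_subset_iff not_less)
    then have "\<forall>\<^sub>F t in at_top. norm (x t) < norm xstar"
      using eventually_at_top_linorder by blast
    then show ?thesis
      by (intro convergence) (erule eventually_mono, simp)
  next
    assume "x ` {S..} \<subseteq> - ball 0 (norm xstar)"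
    then have "norm xstar \<le> norm (x t)" if "S \<le> t" for t
      using that by (auto simp: image_subset_iff not_less)
    then have "\<forall>\<^sub>F t in at_top. norm xstar \<le> norm (x t)"
      using eventually_at_top_linorder by blast
    then show ?thesis
      using outside convergence by blast
  qed
  ultimately show ?thesis by blast
qed

end
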